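(* For every positive integer $k$, there exists a $2k$-strong digraph $D$ with $\delta^+(D)=2k$ which has no spanning $3$-partite subdigraph $H$ with $\delta^0(H)\ge k+1$.
   Context: Digraphs are finite, without loops or parallel arcs (directed $2$-cycles are allowed). $\delta^+(D)$ is the minimum out-degree of a vertex of $D$, and $\delta^0(D)$ is the minimum over all in-degrees and out-degrees of vertices of $D$. A digraph is strong if for every ordered pair of vertices $u,v$ there is a directed path from $u$ to $v$. A digraph $D=(V,A)$ is $r$-strong if it has at least $r+1$ vertices and $D-X$ is strong for every $X\subset V$ with $|X|<r$. A subdigraph is spanning if it contains all vertices. A digraph is $3$-partite if its vertex set can be partitioned into $3$ (possibly empty) sets each of which induces no arc. *)

theory Defs
  imports "Graph_Theory.Digraph_Component"
begin

definition min_out_degree :: "('a, 'b) pre_digraph \<Rightarrow> nat" where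
  "min_out_degree G = Min (out_degree G ` verts G)"

definition min_semidegree :: "('a, 'b) pre_digraph \<Rightarrow> nat" where
  "min_semidegree G = Min (in_degree G ` verts G \<union> out_degree G ` verts G)"

(* strongly_connected excludes the null graph; this adds no condition here,
   because card X < r < card (verts G) leaves at least one vertex. *)
definition r_strong :: "nat \<Rightarrow> ('a, 'b) pre_digraph \<Rightarrow> bool" where
  "r_strong r G \<longleftrightarrow>
     card (verts G) \<ge> r + 1 \<and>
     (\<forall>X. X \<subseteq> verts G \<and> card X < r \<longrightarrow> strongly_connected (G \<restriction> (verts G - X)))"

definition three_partite :: "('a, 'b) pre_digraph \<Rightarrow> bool" where
  "three_partite G \<longleftrightarrow>
     (\<exists>V1 V2 V3. verts G = V1 \<union> V2 \<union> V3 \<and>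
        V1 \<inter> V2 = {} \<and> V1 \<inter> V3 = {} \<and> V2 \<inter> V3 = {} \<and>
        arcs (G \<restriction> V1) = {} \<and> arcs (G \<restriction> V2) = {} \<and> arcs (G \<restriction> V3) = {})"

end

theory Submission
  imports Defs "HOL-Library.Countable"
begin

text \<open>Call a colour big on a set if it occurs at least \<open>k\<close> times there. In a \<open>3\<close>-partite
  spanning subdigraph of minimum semidegree \<open>k + 1\<close>, a vertex whose in-neighbours (or
  out-neighbours) in \<open>D\<close> form a set of \<open>2k\<close> elements cannot have a colour that is big on that set.
  Start from a complete digraph on \<open>3k\<close> vertices, on which some colour is big. Attaching \<open>2k\<close> copies
  of a vertex with in-neighbourhood \<open>S\<close>, for every \<open>2k\<close>-set \<open>S\<close>, makes a further colour big; doing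
  this twice makes all three colours big. Dually, one round of vertices with prescribed
  out-neighbourhoods makes two colours big. A vertex whose out-neighbourhood forbids these two
  colours and whose in-neighbourhood forbids the third cannot be coloured. All vertices without
  prescribed out-neighbourhood dominate the initial set, which in turn dominates all vertices
  without prescribed in-neighbourhood, so that following neighbours outside a deleted set of
  fewer than \<open>2k\<close> vertices connects everything through the initial set.\<close>

section \<open>Digraphs given by relations on countable types\<close>

text \<open>\<open>to_nat\<close> carries a relation over to the type \<open>nat\<close>; an arc is
  the pair of its ends, which rules out parallel arcs.\<close>

definition encode :: "'a::countable set \<Rightarrow> ('a \<times> 'a) set \<Rightarrow> (nat, nat \<times> nat) pre_digraph" where
  "encode V R = \<lparr>verts = to_nat ` V, arcs = map_prod to_nat to_nat ` R, tail = fst, head = snd\<rparr>"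

lemma encode_simps [simp]:
  "verts (encode V R) = to_nat ` V" "arcs (encode V R) = map_prod to_nat to_nat ` R"
  "tail (encode V R) = fst" "head (encode V R) = snd"
  by (simp_all add: encode_def)

lemma digraph_encode:
  assumes "finite V" "R \<subseteq> V \<times> V" "irrefl R"
  shows "digraph (encode V R)"
proof
  show "finite (verts (encode V R))" "finite (arcs (encode V R))"
    using assms finite_subset[of R "V \<times> V"] by auto
qed (use assms in \<open>auto simp: irrefl_def arc_to_ends_def\<close>)

lemma out_degree_encode: "out_degree (encode V R) (to_nat x) = card (R `` {x})"
proof -
  have "out_arcs (encode V R) (to_nat x) = (\<lambda>y. (to_nat x, to_nat y)) ` (R `` {x})"
    by (force simp: out_arcs_def image_iff)
  then show ?thesis
    by (simp add: out_degree_def card_image inj_on_def)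
qed

lemma min_out_degree_encode:
  assumes "finite V" "\<And>x. x \<in> V \<Longrightarrow> d \<le> card (R `` {x})" "z \<in> V" "card (R `` {z}) = d"
  shows "min_out_degree (encode V R) = d"
  unfolding min_out_degree_def
proof (rule Min_eqI)
  show "d \<in> out_degree (encode V R) ` verts (encode V R)"
    using assms(3,4) out_degree_encode[of V R z] by force
qed (use assms(1,2) in \<open>auto simp: out_degree_encode\<close>)

lemma r_strong_encode:
  assumes card: "finite V" "r + 1 \<le> card V"
    and conn: "\<And>X u v. \<lbrakk>X \<subseteq> V; card X < r; u \<in> V - X; v \<in> V - X\<rbrakk> \<Longrightarrow>
      (u, v) \<in> (R \<inter> (V - X) \<times> (V - X))\<^sup>*"
  shows "r_strong r (encode V R)"
  unfolding r_strong_def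
proof (intro conjI allI impI)
  have cV: "card (to_nat ` V) = card V"
    by (simp add: card_image)
  then show "r + 1 \<le> card (verts (encode V R))"
    using card by simp
  fix X' assume X': "X' \<subseteq> verts (encode V R) \<and> card X' < r"
  then obtain X where X: "X' = to_nat ` X" "X \<subseteq> V"
    by (auto simp: subset_image_iff)
  then have cX: "card X < r"
    using X' by (simp add: card_image)
  let ?G = "encode V R \<restriction> (verts (encode V R) - X')"
  have vG: "verts ?G = to_nat ` (V - X)"
    using X by (simp add: image_set_diff)
  have "V - X \<noteq> {}"
    using X cX card by auto
  moreover have "to_nat u \<rightarrow>\<^sup>*\<^bsub>?G\<^esub> to_nat v" if uv: "u \<in> V - X" "v \<in> V - X" for u v
  proof -
    from conn[OF X(2) cX uv] show ?thesis
    proof induction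
      case base
      show ?case
        using uv vG by (simp add: reachable_def)
    next
      case (step y z)
      have "(to_nat y, to_nat z) \<in> map_prod to_nat to_nat ` R"
        using step by auto
      then have "(to_nat y, to_nat z) \<in> arcs_ends ?G"
        using step X by (fastforce simp: arcs_ends_def arc_to_ends_def)
      moreover have "to_nat z \<in> verts ?G"
        unfolding vG using step by blast
      ultimately show ?case
        using step.IH by (simp only: reachable_def) (rule rtrancl_on_into_rtrancl_on)
    qed
  qed
  ultimately show "strongly_connected ?G"
    unfolding strongly_connected_def vG by blast
qed

text \<open>The parts become colours. Arcs of \<open>H\<close> are arcs of \<open>R\<close> with
  ends of different colours, so degrees in \<open>H\<close> bound the numbers of differently
  coloured neighbours from below.\<close>

lemma three_partite_colouring:
  assumes V: "finite V" "R \<subseteq> V \<times> V"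
    and H: "spanning H (encode V R)" "three_partite H" "d \<le> min_semidegree H"
  obtains c :: "'a::countable \<Rightarrow> nat" where "\<And>x. c x < 3"
    "\<And>x. x \<in> V \<Longrightarrow> d \<le> card {y. (x, y) \<in> R \<and> c y \<noteq> c x}"
    "\<And>x. x \<in> V \<Longrightarrow> d \<le> card {y. (y, x) \<in> R \<and> c y \<noteq> c x}"
proof -
  obtain V1 V2 V3 where part: "verts H = V1 \<union> V2 \<union> V3"
      "arcs (H \<restriction> V1) = {}" "arcs (H \<restriction> V2) = {}" "arcs (H \<restriction> V3) = {}"
    using H(2) by (auto simp: three_partite_def)
  have vH: "verts H = to_nat ` V" and aH: "arcs H \<subseteq> map_prod to_nat to_nat ` R"
    and tail: "tail H = fst" and head: "head H = snd"
    using H(1) by (auto simp: spanning_def subgraph_def compatible_def)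
  \<comment> \<open>The third part and everything outside \<open>V\<close> get the default 2, so
    \<open>c x < 3\<close> holds for all \<open>x\<close>.\<close>
  define c where "c x = (if to_nat x \<in> V1 then 0 else if to_nat x \<in> V2 then 1 else (2::nat))" for x :: 'a
  have arcs: "\<exists>x y. e = (to_nat x, to_nat y) \<and> (x, y) \<in> R \<and> c x \<noteq> c y" if e: "e \<in> arcs H" for e
  proof -
    obtain x y where xy: "e = (to_nat x, to_nat y)" "(x, y) \<in> R"
      using e aH by auto
    then have "to_nat x \<in> verts H" "to_nat y \<in> verts H"
      using V vH by auto
    then have "c x \<noteq> c y"
      using part e xy tail head by (auto simp: c_def split: if_splits)
    then show ?thesis
      using xy by blast
  qed
  have fR: "finite R"
    using V finite_subset by blast
  have min: "d \<le> in_degree H (to_nat x)" "d \<le> out_degree H (to_nat x)" if "x \<in> V" for x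
    using that V(1) by (auto simp: min_semidegree_def vH intro!: order_trans[OF H(3)])
  show thesis
  proof
    show "c x < 3" for x
      by (simp add: c_def)
    show "d \<le> card {y. (x, y) \<in> R \<and> c y \<noteq> c x}" (is "_ \<le> card ?S") if "x \<in> V" for x
    proof -
      have fin: "finite ?S"
        by (rule finite_subset[of _ "snd ` R"]) (use fR in force)+
      have "out_arcs H (to_nat x) \<subseteq> (\<lambda>y. (to_nat x, to_nat y)) ` ?S"
        using arcs by (fastforce simp: out_arcs_def tail)
      from surj_card_le[OF fin this] show ?thesis
        using min(2)[OF that] by (simp add: out_degree_def)
    qed
    show "d \<le> card {y. (y, x) \<in> R \<and> c y \<noteq> c x}" (is "_ \<le> card ?S") if "x \<in> V" for x
    proof -
      have fin: "finite ?S"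
        by (rule finite_subset[of _ "fst ` R"]) (use fR in force)+
      have "in_arcs H (to_nat x) \<subseteq> (\<lambda>y. (to_nat y, to_nat x)) ` ?S"
        using arcs by (fastforce simp: in_arcs_def head)
      from surj_card_le[OF fin this] show ?thesis
        using min(1)[OF that] by (simp add: in_degree_def)
    qed
  qed
qed

section \<open>The construction\<close>

text \<open>The list arguments of \<open>Inner\<close> and \<open>Outer\<close> are the in- and out-neighbourhood, respectively;
  \<open>Both\<close> prescribes first the in- and then the out-neighbourhood. The number is the index of the
  copy.\<close>

datatype vertex = Base nat | Inner nat "vertex list" | Outer nat "vertex list"
  | Both "vertex list" "vertex list"

instance vertex :: countable
  by countable_datatype

text \<open>The overlap of the first two equations with the next two is harmless: among the vertices below,
  no \<open>Outer\<close> or \<open>Both\<close> occurs in an in-neighbour list, and no \<open>Inner\<close> or \<open>Both\<close> in an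
  out-neighbour list.\<close>

fun arc :: "vertex \<Rightarrow> vertex \<Rightarrow> bool" where
  "arc x (Inner i xs) \<longleftrightarrow> x \<in> set xs"
| "arc x (Both xs ys) \<longleftrightarrow> x \<in> set xs"
| "arc (Outer i ys) y \<longleftrightarrow> y \<in> set ys"
| "arc (Both xs ys) y \<longleftrightarrow> y \<in> set ys"
| "arc x y \<longleftrightarrow> x \<noteq> y"

definition base :: "nat \<Rightarrow> vertex set" where
  "base k = Base ` {..<3 * k}"

text \<open>Lists stand for \<open>2 * k\<close>-subsets so that a vertex can carry them as
  constructor arguments; different orderings of a set merely yield more vertices.\<close>

definition tuples :: "nat \<Rightarrow> vertex set \<Rightarrow> vertex list set" where
  "tuples k S = {xs. set xs \<subseteq> S \<and> distinct xs \<and> length xs = 2 * k}"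

text \<open>With one colour excluded on the \<open>2 * k\<close> copies for a list, one of the other
  two occurs on at least \<open>k\<close> of them.\<close>

definition attach :: "nat \<Rightarrow> (nat \<Rightarrow> vertex list \<Rightarrow> vertex) \<Rightarrow> vertex set \<Rightarrow> vertex set" where
  "attach k f S = base k \<union> (\<Union>xs\<in>tuples k S. (\<lambda>i. f i xs) ` {..<2 * k})"

definition inn1 :: "nat \<Rightarrow> vertex set" where "inn1 k = attach k Inner (base k)"
definition inn2 :: "nat \<Rightarrow> vertex set" where "inn2 k = attach k Inner (inn1 k)"
definition out1 :: "nat \<Rightarrow> vertex set" where "out1 k = attach k Outer (base k)"

definition vertices :: "nat \<Rightarrow> vertex set" where
  "vertices k = inn2 k \<union> out1 k \<union> case_prod Both ` (tuples k (inn2 k) \<times> tuples k (out1 k))"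

definition varcs :: "nat \<Rightarrow> (vertex \<times> vertex) set" where
  "varcs k = {(x, y) \<in> vertices k \<times> vertices k. arc x y}"

section \<open>Finiteness, inclusions and shapes of the vertex sets\<close>

lemma finite_base [simp]: "finite (base k)"
  by (simp add: base_def)

lemma card_base: "card (base k) = 3 * k"
  by (simp add: base_def card_image inj_on_def)

lemma finite_tuples: "finite S \<Longrightarrow> finite (tuples k S)"
  by (rule finite_subset[OF _ finite_lists_length_eq[of S "2 * k"]]) (auto simp: tuples_def)

lemma finite_attach: "finite S \<Longrightarrow> finite (attach k f S)"
  by (simp add: attach_def finite_tuples)

lemma finite_inn2 [simp]: "finite (inn2 k)" and finite_out1 [simp]: "finite (out1 k)"
  by (simp_all add: inn2_def inn1_def out1_def finite_attach)

lemma finite_inn1 [simp]: "finite (inn1 k)"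
  by (simp add: inn1_def finite_attach)

lemma finite_vertices: "finite (vertices k)"
  by (auto simp: vertices_def finite_tuples)

lemma base_subset: "base k \<subseteq> attach k f S"
  by (simp add: attach_def)

lemma tuples_mono: "S \<subseteq> T \<Longrightarrow> tuples k S \<subseteq> tuples k T"
  by (auto simp: tuples_def)

lemma attach_mono: "S \<subseteq> T \<Longrightarrow> attach k f S \<subseteq> attach k f T"
  using tuples_mono[of S T k] by (auto simp: attach_def)

lemma inn1_subset: "inn1 k \<subseteq> inn2 k"
  unfolding inn1_def inn2_def by (intro attach_mono base_subset)

text \<open>The source of connectivity: fewer than \<open>2 * k\<close> deletions cannot remove a
  whole prescribed neighbourhood.\<close>

lemma tuples_avoid:
  assumes "xs \<in> tuples k S" "finite X" "card X < 2 * k"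
  obtains x where "x \<in> set xs" "x \<in> S" "x \<notin> X"
proof -
  have "card (set xs) = 2 * k"
    using assms(1) by (simp add: tuples_def distinct_card)
  then have "\<not> set xs \<subseteq> X"
    using assms(3) card_mono[OF assms(2)] by (metis not_less)
  then show thesis
    using that assms(1) by (auto simp: tuples_def)
qed

text \<open>Take \<open>k\<close> elements from each class, possibly overlapping, and fill up to
  \<open>2 * k\<close>.\<close>

lemma tuples_exist:
  assumes "finite S" "2 * k \<le> card S" "C1 \<subseteq> S" "k \<le> card C1" "C2 \<subseteq> S" "k \<le> card C2"
  obtains xs where "xs \<in> tuples k S" "k \<le> card (set xs \<inter> C1)" "k \<le> card (set xs \<inter> C2)"
proof -
  obtain A1 where A1: "A1 \<subseteq> C1" "card A1 = k" "finite A1"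
    using obtain_subset_with_card_n[OF assms(4)] by blast
  obtain A2 where A2: "A2 \<subseteq> C2" "card A2 = k" "finite A2"
    using obtain_subset_with_card_n[OF assms(6)] by blast
  have "card (A1 \<union> A2) \<le> 2 * k"
    using card_Un_le[of A1 A2] A1 A2 by simp
  moreover have "A1 \<union> A2 \<subseteq> S"
    using A1 A2 assms by blast
  ultimately obtain T where T: "A1 \<union> A2 \<subseteq> T" "T \<subseteq> S" "card T = 2 * k"
    using exists_subset_between[of "A1 \<union> A2" "2 * k" S] assms by auto
  then have "finite T"
    using assms(1) finite_subset by blast
  then obtain xs where xs: "set xs = T" "distinct xs"
    using finite_distinct_list by blast
  have "card A1 \<le> card (T \<inter> C1)" "card A2 \<le> card (T \<inter> C2)"
    by (intro card_mono; use T A1 A2 \<open>finite T\<close> in blast)+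
  then show thesis
    using that[of xs] xs T A1 A2 distinct_card[of xs] by (simp add: tuples_def)
qed

text \<open>A vertex has larger size than every member of its lists, so it is in none of
  them.\<close>

lemma irrefl_varcs: "irrefl (varcs k)"
proof -
  have "size x < Suc (size_list size xs)" if "x \<in> set xs" for x :: vertex and xs
    using that by (simp add: less_Suc_eq_le size_list_estimation')
  from this[of "Inner _ _"] this[of "Outer _ _"] this[of "Both _ _"]
  have "Inner i xs \<notin> set xs" "Outer i xs \<notin> set xs" "Both xs ys \<notin> set xs" for i xs ys
    by fastforce+
  then have "\<not> arc x x" for x
    by (cases x) auto
  then show ?thesis
    by (auto simp: irrefl_def varcs_def)
qed

lemma attachE:
  assumes "x \<in> attach k f S"
  obtains "x \<in> base k" | i xs where "x = f i xs" "i < 2 * k" "xs \<in> tuples k S"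
  using assms by (auto simp: attach_def)

lemma inn2_shape: "x \<in> inn2 k \<Longrightarrow> (\<exists>i. x = Base i) \<or> (\<exists>i xs. x = Inner i xs)"
  by (auto simp: inn2_def base_def elim!: attachE)

lemma out1_shape: "x \<in> out1 k \<Longrightarrow> (\<exists>i. x = Base i) \<or> (\<exists>i ys. x = Outer i ys)"
  by (auto simp: out1_def base_def elim!: attachE)

lemma base_subset_inn1: "base k \<subseteq> inn1 k" and base_subset_inn2: "base k \<subseteq> inn2 k"
  and base_subset_out1: "base k \<subseteq> out1 k"
  by (simp_all add: inn1_def inn2_def out1_def base_subset)

lemma verticesE:
  assumes "x \<in> vertices k"
  obtains "x \<in> inn2 k" | "x \<in> out1 k"
    | xs ys where "x = Both xs ys" "xs \<in> tuples k (inn2 k)" "ys \<in> tuples k (out1 k)"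
  using assms by (auto simp: vertices_def)

lemma inn2_subset_vertices: "inn2 k \<subseteq> vertices k" and out1_subset_vertices: "out1 k \<subseteq> vertices k"
  by (auto simp: vertices_def)

section \<open>Connectivity and out-degrees\<close>

lemma strong_vertices:
  assumes X: "X \<subseteq> vertices k" "card X < 2 * k" and uv: "u \<in> vertices k - X" "v \<in> vertices k - X"
  shows "(u, v) \<in> (varcs k \<inter> (vertices k - X) \<times> (vertices k - X))\<^sup>*"
proof -
  let ?V = "vertices k - X"
  let ?r = "varcs k \<inter> ?V \<times> ?V"
  have fX: "finite X"
    using X(1) finite_vertices finite_subset by blast
  have "\<not> base k \<subseteq> X"
    using card_mono[OF fX, of "base k"] X(2) by (auto simp: card_base)
  then obtain b where b: "b \<in> base k" "b \<notin> X"
    by blast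
  obtain j where j: "b = Base j"
    using b by (auto simp: base_def)
  have step: "(x, y) \<in> ?r\<^sup>*" if "arc x y \<or> x = y" "x \<in> ?V" "y \<in> ?V" for x y
    using that by (auto simp: varcs_def)
  have bV: "base k - X \<subseteq> ?V" "inn1 k - X \<subseteq> ?V" "inn2 k - X \<subseteq> ?V" "out1 k - X \<subseteq> ?V"
    using inn2_subset_vertices out1_subset_vertices inn1_subset base_subset_inn2 by blast+
  \<comment> \<open>\<open>x\<close> is a \<open>Base\<close> or \<open>Inner\<close> vertex and
    \<open>b\<close> a \<open>Base\<close> vertex, so the last equation of \<open>arc\<close> gives
    a direct arc unless \<open>x = b\<close>.\<close>
  have to_base: "(x, b) \<in> ?r\<^sup>*" if "x \<in> inn2 k" "x \<notin> X" for x
    by (rule step) (use that b j bV inn2_shape[of x k] in auto)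
  have from_base: "(b, y) \<in> ?r\<^sup>*" if "y \<in> out1 k" "y \<notin> X" for y
    by (rule step) (use that b j bV out1_shape[of y k] in auto)
  \<comment> \<open>A surviving member of the prescribed in-neighbourhood relays the path; this
    serves both rounds of \<open>Inner\<close> vertices.\<close>
  have from_attach: "(b, x) \<in> ?r\<^sup>*"
    if S: "\<And>z. z \<in> S \<Longrightarrow> z \<notin> X \<Longrightarrow> (b, z) \<in> ?r\<^sup>*" "S \<subseteq> vertices k"
      and x: "x \<in> attach k Inner S" "x \<notin> X" "x \<in> vertices k" for S x
    using x(1)
  proof (cases rule: attachE)
    case 1
    then show ?thesis
      using from_base base_subset_out1 x by blast
  next
    case (2 i xs)
    then obtain z where z: "z \<in> set xs" "z \<in> S" "z \<notin> X"
      using tuples_avoid[OF _ fX X(2)] by blast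
    then have "(z, x) \<in> ?r\<^sup>*"
      using 2 S x by (intro step) auto
    then show ?thesis
      using S(1) z by (meson rtrancl_trans)
  qed
  have from1: "(b, x) \<in> ?r\<^sup>*" if x: "x \<in> inn1 k" "x \<notin> X" for x
  proof (rule from_attach)
    show "(b, z) \<in> ?r\<^sup>*" if "z \<in> base k" "z \<notin> X" for z
      using that from_base base_subset_out1 by blast
    show "x \<in> attach k Inner (base k)"
      using x by (simp add: inn1_def)
  qed (use x bV base_subset_inn2 inn1_subset inn2_subset_vertices in blast)+
  have from2: "(b, x) \<in> ?r\<^sup>*" if x: "x \<in> inn2 k" "x \<notin> X" for x
  proof (rule from_attach)
    show "(b, z) \<in> ?r\<^sup>*" if "z \<in> inn1 k" "z \<notin> X" for z
      using that by (rule from1)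
    show "x \<in> attach k Inner (inn1 k)"
      using x by (simp add: inn2_def)
  qed (use x inn1_subset inn2_subset_vertices in blast)+
  have to1: "(x, b) \<in> ?r\<^sup>*" if x: "x \<in> out1 k" "x \<notin> X" for x
    using x(1) unfolding out1_def
  proof (cases rule: attachE)
    case 1
    then show ?thesis
      using to_base base_subset_inn2 x by blast
  next
    case (2 i ys)
    then obtain z where z: "z \<in> set ys" "z \<in> base k" "z \<notin> X"
      using tuples_avoid[OF _ fX X(2)] by blast
    then have "arc x z"
      using 2 by (auto simp: base_def)
    then have "(x, z) \<in> ?r\<^sup>*"
      using z x bV by (intro step) auto
    moreover have "(z, b) \<in> ?r\<^sup>*"
      using to_base z base_subset_inn2 by blast
    ultimately show ?thesis
      by (rule rtrancl_trans)
  qed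
  have from_b: "(b, x) \<in> ?r\<^sup>*" if x: "x \<in> ?V" for x
  proof -
    have "x \<in> vertices k"
      using x by blast
    then show ?thesis
    proof (cases rule: verticesE)
      case (3 xs ys)
      then obtain z where z: "z \<in> set xs" "z \<in> inn2 k" "z \<notin> X"
        using tuples_avoid[OF _ fX X(2)] by blast
      then have "(z, x) \<in> ?r\<^sup>*"
        using 3 x bV by (intro step) auto
      then show ?thesis
        using from2 z by (meson rtrancl_trans)
    qed (use x from2 from_base in auto)
  qed
  have to_b: "(x, b) \<in> ?r\<^sup>*" if x: "x \<in> ?V" for x
  proof -
    have "x \<in> vertices k"
      using x by blast
    then show ?thesis
    proof (cases rule: verticesE)
      case (3 xs ys)
      then obtain z where z: "z \<in> set ys" "z \<in> out1 k" "z \<notin> X"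
        using tuples_avoid[OF _ fX X(2)] by blast
      then have "arc x z"
        using 3 out1_shape by fastforce
      then have "(x, z) \<in> ?r\<^sup>*"
        using z x bV by (intro step) auto
      then show ?thesis
        using to1 z by (meson rtrancl_trans)
    qed (use x to_base to1 in auto)
  qed
  show ?thesis
    using to_b[OF uv(1)] from_b[OF uv(2)] by (rule rtrancl_trans)
qed

section \<open>Exact out-neighbourhoods and out-degrees\<close>

lemma finite_varcs_Image: "finite (varcs k `` A)"
  by (rule finite_subset[OF _ finite_vertices[of k]]) (auto simp: varcs_def)

lemma card_tuples: "xs \<in> tuples k S \<Longrightarrow> card (set xs) = 2 * k"
  by (simp add: tuples_def distinct_card)

text \<open>All in-neighbour lists consist of vertices of \<open>inn2 k\<close>, so the head
  \<open>y\<close> can be neither \<open>Inner\<close> nor \<open>Both\<close>.\<close>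

lemma head_in_out1:
  assumes "x \<notin> inn2 k" "y \<in> vertices k" "arc x y"
  shows "y \<in> out1 k"
  using assms(2)
proof (cases rule: verticesE)
  case 1
  then show ?thesis
    unfolding inn2_def
  proof (cases rule: attachE)
    case (2 i zs)
    then show ?thesis
      using assms(1,3) inn1_subset by (auto simp: tuples_def)
  qed (use base_subset_out1 in blast)
next
  case (3 zs ws)
  then show ?thesis
    using assms(1,3) by (auto simp: tuples_def)
qed

text \<open>Serves twice: the out-degree \<open>2 * k\<close> is attained, and the big colours of
  \<open>ys\<close> are forbidden at this vertex.\<close>

lemma out_neighbours_Both:
  assumes "xs \<in> tuples k (inn2 k)" "ys \<in> tuples k (out1 k)"
  shows "varcs k `` {Both xs ys} = set ys"
proof -
  have nin: "Both xs ys \<notin> inn2 k"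
    using inn2_shape by blast
  have "arc (Both xs ys) y \<longleftrightarrow> y \<in> set ys" if "y \<in> out1 k" for y
    using out1_shape[OF that] by auto
  moreover have "set ys \<subseteq> out1 k"
    using assms by (simp add: tuples_def)
  moreover have "Both xs ys \<in> vertices k"
    using assms by (auto simp: vertices_def)
  ultimately show ?thesis
    using head_in_out1[OF nin] subsetD[OF out1_subset_vertices] by (auto simp: varcs_def)
qed

lemma out_degree_varcs:
  assumes "k > 0" "x \<in> vertices k"
  shows "2 * k \<le> card (varcs k `` {x})"
proof -
  have base: "?thesis" if x: "x \<in> inn2 k"
  proof -
    have "base k - {x} \<subseteq> varcs k `` {x}"
      using x base_subset_inn2 inn2_subset_vertices inn2_shape[OF x]
      by (auto simp: varcs_def base_def)
    from card_mono[OF finite_varcs_Image this]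
    have "card (base k - {x}) \<le> card (varcs k `` {x})" .
    \<comment> \<open>One is lost if \<open>x\<close> is itself in the base; \<open>k > 0\<close>
      still gives at least \<open>2 * k\<close>.\<close>
    moreover have "3 * k - 1 \<le> card (base k - {x})"
      using diff_card_le_card_Diff[of "{x}" "base k"] by (simp add: card_base)
    ultimately show ?thesis
      using assms(1) by linarith
  qed
  show ?thesis
    using assms(2)
  proof (cases rule: verticesE)
    case 2
    then show ?thesis
      unfolding out1_def
    proof (cases rule: attachE)
      case 1
      then show ?thesis
        using base base_subset_inn2 by blast
    next
      case (2 i ys)
      then have "set ys \<subseteq> varcs k `` {x}"
        using assms(2) base_subset_inn2 inn2_subset_vertices
        by (fastforce simp: varcs_def tuples_def base_def)
      from card_mono[OF finite_varcs_Image this] show ?thesis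
        using card_tuples 2 by simp
    qed
  qed (use base out_neighbours_Both card_tuples in auto)
qed

section \<open>Colourings\<close>

definition big :: "nat \<Rightarrow> ('a \<Rightarrow> nat) \<Rightarrow> 'a set \<Rightarrow> nat \<Rightarrow> bool" where
  "big k c S a \<longleftrightarrow> k \<le> card {x \<in> S. c x = a}"

lemma big_mono: "\<lbrakk>big k c S a; S \<subseteq> T; finite T\<rbrakk> \<Longrightarrow> big k c T a"
  unfolding big_def by (rule order_trans[OF _ card_mono]) auto

text \<open>At least \<open>k + 1\<close> of at most \<open>2 * k\<close> elements avoid
  \<open>a\<close>, leaving fewer than \<open>k\<close> with colour \<open>a\<close>.\<close>

lemma few_own_colour:
  assumes "finite N" "card N \<le> 2 * k" "M \<subseteq> N" "k + 1 \<le> card {y \<in> M. c y \<noteq> a}"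
  shows "\<not> big k c N a"
proof -
  have "card N = card {y \<in> N. c y = a} + card {y \<in> N. c y \<noteq> a}"
    using assms(1) by (subst card_Un_disjoint[symmetric]) (auto intro: arg_cong[where f = card])
  moreover have "card {y \<in> M. c y \<noteq> a} \<le> card {y \<in> N. c y \<noteq> a}"
    using assms(1,3) by (intro card_mono) auto
  ultimately show ?thesis
    using assms(2,4) by (simp add: big_def)
qed

lemma big_exists:
  assumes "finite S" "finite C" "C \<noteq> {}" "c ` S \<subseteq> C" "card C * k \<le> card S"
  shows "\<exists>a\<in>C. big k c S a"
proof -
  obtain a where a: "a \<in> C" "card S \<le> card (c -` {a} \<inter> S) * card C"
    using pigeonhole_card[of c S C] assms by auto
  have "card C * k \<le> card C * card (c -` {a} \<inter> S)"
    using order_trans[OF assms(5) a(2)] by (simp only: mult.commute)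
  then have "k \<le> card (c -` {a} \<inter> S)"
    using assms(2,3) by (simp only: mult_le_cancel1 card_gt_0_iff) simp
  moreover have "c -` {a} \<inter> S = {x \<in> S. c x = a}"
    by auto
  ultimately show ?thesis
    using a(1) by (auto simp: big_def)
qed

lemma tuples_big:
  assumes "finite S" "2 * k \<le> card S" "big k c S a" "big k c S b"
  shows "\<exists>xs\<in>tuples k S. big k c (set xs) a \<and> big k c (set xs) b"
proof -
  obtain xs where xs: "xs \<in> tuples k S" and
    "k \<le> card (set xs \<inter> {x \<in> S. c x = a})" "k \<le> card (set xs \<inter> {x \<in> S. c x = b})"
    using assms tuples_exist[of S k "{x \<in> S. c x = a}" "{x \<in> S. c x = b}"] by (auto simp: big_def)
  moreover have "set xs \<inter> {x \<in> S. c x = e} = {x \<in> set xs. c x = e}" for e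
    using xs by (auto simp: tuples_def)
  ultimately show ?thesis
    by (auto simp: big_def)
qed

text \<open>The copies for a list on which \<open>a\<close> and \<open>b\<close> are big avoid both
  colours. One or two colours remain, as \<open>a = b\<close> is allowed, so the pigeonhole
  principle on \<open>2 * k\<close> copies yields a big one.\<close>

lemma big_attach:
  assumes c: "\<And>x. c x < 3" and ab: "a < 3" "b < 3"
    and S: "finite S" "2 * k \<le> card S" "big k c S a" "big k c S b"
    and inj: "\<And>xs. inj (\<lambda>i. f i xs)"
    and few: "\<And>xs i. \<lbrakk>xs \<in> tuples k S; i < 2 * k\<rbrakk> \<Longrightarrow> \<not> big k c (set xs) (c (f i xs))"
  shows "\<exists>d<3. d \<noteq> a \<and> d \<noteq> b \<and> big k c (attach k f S) d"
proof -
  obtain xs where xs: "xs \<in> tuples k S" and "big k c (set xs) a" "big k c (set xs) b"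
    using tuples_big S by blast
  then have ne: "c (f i xs) \<noteq> a" "c (f i xs) \<noteq> b" if "i < 2 * k" for i
    using few[OF xs that] by auto
  let ?T = "(\<lambda>i. f i xs) ` {..<2 * k}" and ?C = "{..<3} - {a, b}"
  have "card {a, b} \<le> 2"
    by (simp add: card_insert_if)
  then have "0 < card ?C"
    using diff_card_le_card_Diff[of "{a, b}" "{..<3}"] by simp
  moreover have "card ?C \<le> card ({..<3} - {a})"
    by (intro card_mono) auto
  then have "card ?C * k \<le> 2 * k"
    using ab by simp
  moreover have "card ?T = 2 * k"
    using inj[of xs] by (simp add: card_image inj_on_def)
  moreover have "c ` ?T \<subseteq> ?C"
    using ne c by auto
  ultimately have "\<exists>d\<in>?C. big k c ?T d"
    by (intro big_exists) (auto simp: card_gt_0_iff)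
  then obtain d where "d \<in> ?C" "big k c ?T d" ..
  moreover have "?T \<subseteq> attach k f S"
    using xs by (auto simp: attach_def)
  ultimately show ?thesis
    using S(1) by (auto intro: big_mono finite_attach)
qed

lemma no_colouring:
  fixes c :: "vertex \<Rightarrow> nat"
  assumes c: "\<And>x. c x < 3"
    and out: "\<And>x. x \<in> vertices k \<Longrightarrow> k + 1 \<le> card {y. (x, y) \<in> varcs k \<and> c y \<noteq> c x}"
    and inn: "\<And>x. x \<in> vertices k \<Longrightarrow> k + 1 \<le> card {y. (y, x) \<in> varcs k \<and> c y \<noteq> c x}"
  shows False
proof -
  have few_in: "\<not> big k c (set xs) (c x)"
    if "x \<in> vertices k" "xs \<in> tuples k S" "\<And>y. arc y x \<longleftrightarrow> y \<in> set xs" for x xs S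
  proof (rule few_own_colour)
    show "k + 1 \<le> card {y \<in> {y. (y, x) \<in> varcs k}. c y \<noteq> c x}"
      using inn[OF that(1)] by simp
  qed (use that card_tuples in \<open>auto simp: varcs_def\<close>)
  have few_out: "\<not> big k c (set ys) (c x)"
    if "x \<in> vertices k" "ys \<in> tuples k S" "varcs k `` {x} \<subseteq> set ys" for x ys S
  proof (rule few_own_colour)
    show "k + 1 \<le> card {y \<in> varcs k `` {x}. c y \<noteq> c x}"
      using out[OF that(1)] by simp
  qed (use that card_tuples in auto)
  have Inner: "\<not> big k c (set xs) (c (Inner i xs))" if "xs \<in> tuples k (inn1 k)" "i < 2 * k" for xs i
  proof (rule few_in)
    show "Inner i xs \<in> vertices k"
      using that inn2_subset_vertices by (force simp: inn2_def attach_def)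
  qed (use that in auto)
  have Outer: "\<not> big k c (set ys) (c (Outer i ys))" if "ys \<in> tuples k (base k)" "i < 2 * k" for ys i
  proof (rule few_out)
    show "Outer i ys \<in> vertices k"
      using that out1_subset_vertices by (force simp: out1_def attach_def)
    \<comment> \<open>The equations of \<open>arc\<close> for heads \<open>Inner\<close> and
      \<open>Both\<close> take precedence over the one for tail \<open>Outer\<close>;
      \<open>head_in_out1\<close> excludes such heads.\<close>
    have "Outer i ys \<notin> inn2 k"
      using inn2_shape by blast
    moreover have "y \<in> set ys" if "arc (Outer i ys) y" "y \<in> out1 k" for y
      using that out1_shape[of y k] by auto
    ultimately show "varcs k `` {Outer i ys} \<subseteq> set ys"
      using head_in_out1 by (auto simp: varcs_def)
  qed (use that in auto)
  obtain a where a: "a < 3" "big k c (base k) a"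
    using big_exists[of "base k" "{..<3}" c k] c by (auto simp: card_base)
  have card: "2 * k \<le> card S" if "base k \<subseteq> S" "finite S" for S
    using card_mono[OF that(2,1)] by (simp add: card_base)
  obtain b where b: "b < 3" "b \<noteq> a" "big k c (inn1 k) b"
  proof -
    \<comment> \<open>The repeated inequality is \<open>big_attach\<close> with \<open>a\<close> in
      both places.\<close>
    have "\<exists>b<3. b \<noteq> a \<and> b \<noteq> a \<and> big k c (inn1 k) b"
      unfolding inn1_def
    proof (rule big_attach[OF c])
      fix xs i assume "xs \<in> tuples k (base k)" "i < 2 * k"
      then show "\<not> big k c (set xs) (c (Inner i xs))"
        using tuples_mono[OF base_subset_inn1] by (intro Inner) auto
    qed (use a card in \<open>auto simp: inj_def\<close>)
    then show thesis
      using that by blast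
  qed
  have a1: "big k c (inn1 k) a"
    using big_mono[OF a(2) base_subset_inn1] by simp
  obtain d where d: "d < 3" "d \<noteq> a" "d \<noteq> b" "big k c (inn2 k) d"
  proof -
    have "\<exists>d<3. d \<noteq> a \<and> d \<noteq> b \<and> big k c (inn2 k) d"
      unfolding inn2_def
      by (rule big_attach[OF c])
        (use a b a1 Inner card base_subset_inn1 in \<open>auto simp: inj_def\<close>)
    then show thesis
      using that by blast
  qed
  have big2: "big k c (inn2 k) e" if "e < 3" for e
  proof -
    have "e = a \<or> e = b \<or> e = d"
      using that a(1) b(1,2) d(1-3) by linarith
    moreover have "big k c (inn2 k) a" "big k c (inn2 k) b"
      using big_mono[OF _ inn1_subset] a1 b(3) by simp_all
    ultimately show ?thesis
      using d(4) by auto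
  qed
  obtain e where e: "e < 3" "e \<noteq> a" "big k c (out1 k) e"
  proof -
    have "\<exists>e<3. e \<noteq> a \<and> e \<noteq> a \<and> big k c (out1 k) e"
      unfolding out1_def
      by (rule big_attach[OF c]) (use a Outer card in \<open>auto simp: inj_def\<close>)
    then show thesis
      using that by blast
  qed
  have a2: "big k c (out1 k) a"
    using big_mono[OF a(2) base_subset_out1] by simp
  have choose: "\<exists>xs\<in>tuples k S. big k c (set xs) g \<and> big k c (set xs) h"
    if S: "finite S" "base k \<subseteq> S" "big k c S g" "big k c S h" for S g h
    using tuples_big S card by blast
  obtain ys where ys: "ys \<in> tuples k (out1 k)" "big k c (set ys) a" "big k c (set ys) e"
    using choose[OF _ base_subset_out1 a2 e(3)] by auto
  \<comment> \<open>The colours 0, 1, 2 sum to 3, so this is the third colour besides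
    \<open>a\<close> and \<open>e\<close>.\<close>
  define f where "f = 3 - a - e"
  have f: "f < 3" "f \<noteq> a" "f \<noteq> e"
    using a(1) e(1,2) unfolding f_def by presburger+
  obtain xs where xs: "xs \<in> tuples k (inn2 k)" "big k c (set xs) f"
    using choose[OF _ base_subset_inn2 big2[OF f(1)] big2[OF f(1)]] by auto
  \<comment> \<open>Its out-neighbours forbid \<open>a\<close> and \<open>e\<close>, its
    in-neighbours forbid \<open>f\<close>.\<close>
  let ?w = "Both xs ys"
  have w: "?w \<in> vertices k"
    using xs ys by (auto simp: vertices_def)
  have "\<not> big k c (set ys) (c ?w)"
    using few_out[OF w ys(1)] out_neighbours_Both[OF xs(1) ys(1)] by simp
  then have "c ?w \<noteq> a" "c ?w \<noteq> e"
    using ys by auto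
  moreover have "\<not> big k c (set xs) (c ?w)"
    by (rule few_in[OF w xs(1)]) auto
  then have "c ?w \<noteq> f"
    using xs by auto
  ultimately show False
    using c[of ?w] a(1) e(1,2) f by linarith
qed

theorem theorem7p2:
  fixes k :: nat
  assumes "k > 0"
  shows "\<exists>D :: (nat, nat \<times> nat) pre_digraph.
           digraph D \<and> r_strong (2 * k) D \<and> min_out_degree D = 2 * k \<and>
           \<not> (\<exists>H. spanning H D \<and> three_partite H \<and> min_semidegree H \<ge> k + 1)"
proof (intro exI conjI)
  let ?D = "encode (vertices k) (varcs k)"
  have sub: "varcs k \<subseteq> vertices k \<times> vertices k"
    by (auto simp: varcs_def)
  show "digraph ?D"
    using finite_vertices sub irrefl_varcs by (rule digraph_encode)
  have base: "base k \<subseteq> vertices k"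
    using base_subset_inn2 inn2_subset_vertices by blast
  have "3 * k \<le> card (vertices k)"
    using card_mono[OF finite_vertices base] by (simp add: card_base)
  then show "r_strong (2 * k) ?D"
    using assms by (intro r_strong_encode finite_vertices strong_vertices) auto
  \<comment> \<open>A list from the base can serve as in- and out-neighbourhood at once, giving a
    \<open>Both\<close> vertex of out-degree exactly \<open>2 * k\<close>.\<close>
  obtain xs where xs: "xs \<in> tuples k (base k)"
    by (rule tuples_exist[of "base k" k "base k" "base k"]) (simp_all add: card_base)
  then have xs': "xs \<in> tuples k (inn2 k)" "xs \<in> tuples k (out1 k)"
    using tuples_mono[OF base_subset_inn2] tuples_mono[OF base_subset_out1] by blast+
  have "Both xs xs \<in> vertices k"
    using xs' by (force simp: vertices_def)
  moreover have "card (varcs k `` {Both xs xs}) = 2 * k"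
    using out_neighbours_Both[OF xs'] card_tuples[OF xs] by simp
  ultimately show "min_out_degree ?D = 2 * k"
    using out_degree_varcs[OF assms] by (intro min_out_degree_encode finite_vertices)
  show "\<not> (\<exists>H. spanning H ?D \<and> three_partite H \<and> min_semidegree H \<ge> k + 1)"
  proof
    assume "\<exists>H. spanning H ?D \<and> three_partite H \<and> min_semidegree H \<ge> k + 1"
    then obtain H where "spanning H ?D" "three_partite H" "k + 1 \<le> min_semidegree H"
      by blast
    then show False
      by (rule three_partite_colouring[OF finite_vertices sub]) (rule no_colouring)
  qed
qed

end
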